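(* Let $\alpha>0$, $\lambda>0$, $\mu\in\mathbb{R}$, $\sigma>0$, and let $X\in Exp\text{-}Fr(\alpha,\lambda;\mu,\sigma)$. Let $p_0\in(0,0.5]$ denote the solution $p$ of the equation $$\left(\frac{2p(1-p)}{2-p}\right)^{\lambda}\log\left[1-(1-p)^{\frac1\alpha}\right]=\log\left[1-2^{-\frac1\alpha}\right].$$ Then for all $p\in(0,0.5]$: (i) $p_{A,L,p}(X)=0$ if $p\in(0,p_0]$, and if $p\in(p_0,0.5]$, then $$p_{A,L,p}(X)=1-\left\{1-\exp\left\{-\left(\frac{2-p}{p}\left\{-\log\left[1-(1-p)^{\frac1\alpha}\right]\right\}^{-\frac1\lambda}-2\,\frac{1-p}{p}\left\{-\log\left[1-2^{-\frac1\alpha}\right]\right\}^{-\frac1\lambda}\right)^{-\lambda}\right\}\right\}^{\alpha};$$ (ii) $$p_{A,R,p}(X)=\left\{1-\exp\left\{-\left(\frac{2-p}{p}\left[-\log\left(1-p^{\frac1\alpha}\right)\right]^{-\frac1\lambda}-2\,\frac{1-p}{p}\left[-\log\left(1-2^{-\frac1\alpha}\right)\right]^{-\frac1\lambda}\right)^{-\lambda}\right\}\right\}^{\alpha}.$$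
   Context: For a real random variable $X$ with cumulative distribution function $F_X(x)=\mathbb{P}(X\le x)$, the quantile function is $F_X^{\leftarrow}(y)=\inf\{x\in\mathbb{R}:F_X(x)\ge y\}$ for $y\in(0,1]$. For $p\in(0,0.5]$, the theoretical asymmetric right and left $p$-fences of $X$ are $$R^A(X,p)=F_X^{\leftarrow}(1-p)+2\,\frac{1-p}{p}\left(F_X^{\leftarrow}(1-p)-F_X^{\leftarrow}(0.5)\right),$$ $$L^A(X,p)=F_X^{\leftarrow}(p)-2\,\frac{1-p}{p}\left(F_X^{\leftarrow}(0.5)-F_X^{\leftarrow}(p)\right).$$ The probabilities for asymmetric right and left $p$-outside values are $$p_{A,R,p}(X)=\mathbb{P}(X>R^A(X,p)),\qquad p_{A,L,p}(X)=\mathbb{P}(X<L^A(X,p)).$$ For $\alpha>0$, $\lambda>0$, $\mu\in\mathbb{R}$, $\sigma>0$, the notation $X\in Exp\text{-}Fr(\alpha,\lambda;\mu,\sigma)$ (Exponentiated Fréchet distribution) means that $$F_X(x)=1-\left[1-\exp\left\{-\left(\frac{x-\mu}{\sigma}\right)^{-\lambda}\right\}\right]^{\alpha}\quad\text{for }x>\mu,$$ and $F_X(x)=0$ for $x\le\mu$. Here $\log$ is the natural logarithm.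
   Formalization: The equation for p_0 is corrected: the base of the power is 2(1-p)/(2-p) instead of 2p(1-p)/(2-p); the printed equation has no solution for α=λ=1, and any solution it has lies below the level at which the left fence reaches μ. *)

theory Defs
  imports "HOL-Probability.Probability"
begin

text \<open>The infimum is that of a nonempty set bounded below whenever \<open>0 < y < 1\<close>, which covers every
  level used below. At \<open>y = 1\<close> the set may be empty, and \<open>Inf {}\<close> is then unspecified instead of
  \<open>+\<infinity>\<close>.\<close>

definition quantile :: "'a measure \<Rightarrow> ('a \<Rightarrow> real) \<Rightarrow> real \<Rightarrow> real" where
  "quantile M X y = Inf {x. cdf (distr M borel X) x \<ge> y}"

definition right_fence :: "'a measure \<Rightarrow> ('a \<Rightarrow> real) \<Rightarrow> real \<Rightarrow> real" where
  "right_fence M X p = quantile M X (1 - p)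
     + 2 * ((1 - p) / p) * (quantile M X (1 - p) - quantile M X (1/2))"

definition left_fence :: "'a measure \<Rightarrow> ('a \<Rightarrow> real) \<Rightarrow> real \<Rightarrow> real" where
  "left_fence M X p = quantile M X p
     - 2 * ((1 - p) / p) * (quantile M X (1/2) - quantile M X p)"

definition prob_right_outside :: "'a measure \<Rightarrow> ('a \<Rightarrow> real) \<Rightarrow> real \<Rightarrow> real" where
  "prob_right_outside M X p = measure M {\<omega> \<in> space M. X \<omega> > right_fence M X p}"

definition prob_left_outside :: "'a measure \<Rightarrow> ('a \<Rightarrow> real) \<Rightarrow> real \<Rightarrow> real" where
  "prob_left_outside M X p = measure M {\<omega> \<in> space M. X \<omega> < left_fence M X p}"

definition exp_frechet ::
  "'a measure \<Rightarrow> ('a \<Rightarrow> real) \<Rightarrow> real \<Rightarrow> real \<Rightarrow> real \<Rightarrow> real \<Rightarrow> bool" where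
  "exp_frechet M X \<alpha> lam \<mu> \<sigma> \<longleftrightarrow>
     X \<in> borel_measurable M \<and>
     (\<forall>x. cdf (distr M borel X) x =
        (if x > \<mu> then 1 - (1 - exp (- (((x - \<mu>) / \<sigma>) powr (- lam)))) powr \<alpha> else 0))"

text \<open>The equation for the level \<open>p\<^sub>0\<close> at which the left fence equals the left end point \<open>\<mu>\<close> of the
  distribution. It comes from
  \<open>(2 - p) / p * (- ln (1 - (1 - p) powr (1/\<alpha>))) powr (- 1/lam)
     = 2 * ((1 - p) / p) * (- ln (1 - 2 powr (- 1/\<alpha>))) powr (- 1/lam)\<close>,
  where the factors \<open>1 / p\<close> on the two sides cancel. The source prints the base of the power as
  \<open>2 * p * (1 - p) / (2 - p)\<close>, with a superfluous factor \<open>p\<close>: that equation has no solution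
  in \<open>(0, 1/2]\<close> for \<open>\<alpha> = lam = 1\<close>, and where it has one, that solution is not the level
  at which the left fence reaches \<open>\<mu>\<close>.\<close>

definition left_threshold :: "real \<Rightarrow> real \<Rightarrow> real \<Rightarrow> bool" where
  "left_threshold \<alpha> lam p \<longleftrightarrow>
     0 < p \<and> p \<le> 1/2 \<and>
     (2 * (1 - p) / (2 - p)) powr lam * ln (1 - (1 - p) powr (1 / \<alpha>))
       = ln (1 - 2 powr (- (1 / \<alpha>)))"

end

theory Submission
  imports Defs
begin

text \<open>Everything reduces to the standard variable \<open>(X - \<mu>) / \<sigma>\<close>. Its distribution function
  \<open>std_cdf\<close> and quantile function \<open>std_quantile\<close> form a Galois connection, which identifies the
  quantiles of \<open>X\<close>. The left fence is \<open>\<mu> + \<sigma> * (2 - p) / p * left_gap p\<close>, where \<open>left_gap\<close> is strictly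
  increasing and changes sign on \<open>(0, 1/2]\<close>; its zero is \<open>p\<^sub>0\<close>. Since the distribution function is
  continuous to the right of \<open>\<mu>\<close>, the outside probabilities are its values at the fences.\<close>

section \<open>The standard distribution function and its quantile function\<close>

definition std_cdf :: "real \<Rightarrow> real \<Rightarrow> real \<Rightarrow> real" where
  "std_cdf \<alpha> lam w = 1 - (1 - exp (- (w powr (- lam)))) powr \<alpha>"

definition std_quantile :: "real \<Rightarrow> real \<Rightarrow> real \<Rightarrow> real" where
  "std_quantile \<alpha> lam y = (- ln (1 - (1 - y) powr (1 / \<alpha>))) powr (- (1 / lam))"

text \<open>The factor \<open>(2 - p) / p\<close> is divided out of the standardized left fence.
  This preserves the sign and leaves a decreasing coefficient in front of the median, so that
  monotonicity in \<open>p\<close> becomes visible.\<close>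

definition left_gap :: "real \<Rightarrow> real \<Rightarrow> real \<Rightarrow> real" where
  "left_gap \<alpha> lam p = std_quantile \<alpha> lam p - 2 * (1 - p) / (2 - p) * std_quantile \<alpha> lam (1/2)"

text \<open>Makes the median terms, printed with powers of 2, the instance \<open>y = 1/2\<close> of
  the general quantile formula.\<close>

lemma half_powr: "(1 - 1/2 :: real) powr a = 2 powr (- a)"
  by (simp add: powr_minus powr_divide field_simps)

lemma powr_unit_bounds:
  fixes y a :: real
  assumes "0 < y" "y < 1" "0 < a"
  shows "0 < (1 - y) powr a" "(1 - y) powr a < 1"
  using assms powr_less_mono2[of a "1 - y" 1] by auto

lemma neg_ln_pos:
  fixes y \<alpha> :: real
  assumes "0 < y" "y < 1" "\<alpha> > 0"
  shows "0 < - ln (1 - (1 - y) powr (1 / \<alpha>))"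
  using powr_unit_bounds[of y "1/\<alpha>"] assms by simp

lemma std_quantile_pos:
  assumes "0 < y" "y < 1" "\<alpha> > 0"
  shows "0 < std_quantile \<alpha> lam y"
  using neg_ln_pos[OF assms] unfolding std_quantile_def by simp

lemma std_cdf_bounds:
  assumes "\<alpha> > 0" "w > 0"
  shows "0 < std_cdf \<alpha> lam w" "std_cdf \<alpha> lam w < 1"
  using powr_unit_bounds[of "exp (- (w powr (- lam)))" \<alpha>] assms by (auto simp: std_cdf_def)

lemma powr_le_iff_inverse:
  fixes x y a :: real
  assumes "0 < a" "0 \<le> x" "0 \<le> y"
  shows "x powr a \<le> y \<longleftrightarrow> x \<le> y powr (1 / a)"
proof
  assume "x powr a \<le> y"
  then have "(x powr a) powr (1/a) \<le> y powr (1/a)"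
    using assms by (intro powr_mono2) auto
  then show "x \<le> y powr (1/a)" using assms by (simp add: powr_powr)
next
  assume "x \<le> y powr (1/a)"
  then have "x powr a \<le> (y powr (1/a)) powr a"
    using assms by (intro powr_mono2) auto
  then show "x powr a \<le> y" using assms by (simp add: powr_powr)
qed

text \<open>The layers of \<open>std_cdf\<close> are undone one at a time: the outer power, the
  exponential, the reciprocal and the inner power. Positivity of \<open>w\<close> matters:
  \<open>0 powr (- lam) = 0\<close> gives \<open>std_cdf\<close> the value 1 at 0 instead of its
  limit 0.\<close>

lemma std_galois:
  assumes "\<alpha> > 0" "lam > 0" "w > 0" "0 < y" "y < 1"
  shows "y \<le> std_cdf \<alpha> lam w \<longleftrightarrow> std_quantile \<alpha> lam y \<le> w"
proof -
  let ?t = "w powr (- lam)" and ?u = "1 - (1 - y) powr (1 / \<alpha>)"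
  have u: "0 < ?u" "?u < 1" using powr_unit_bounds[of y "1/\<alpha>"] assms by auto
  have c: "0 < - ln ?u" using neg_ln_pos assms by blast
  have "y \<le> std_cdf \<alpha> lam w \<longleftrightarrow> (1 - exp (- ?t)) powr \<alpha> \<le> 1 - y"
    by (auto simp: std_cdf_def)
  also have "\<dots> \<longleftrightarrow> 1 - exp (- ?t) \<le> (1 - y) powr (1 / \<alpha>)"
    using assms by (intro powr_le_iff_inverse) auto
  also have "\<dots> \<longleftrightarrow> ?u \<le> exp (- ?t)" by auto
  also have "\<dots> \<longleftrightarrow> ln ?u \<le> - ?t" using u by (metis exp_le_cancel_iff exp_ln)
  \<comment> \<open>Both \<open>- ln ?u\<close> and \<open>w powr lam\<close> are positive, so
    taking reciprocals reverses the inequality.\<close>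
  also have "\<dots> \<longleftrightarrow> inverse (- ln ?u) \<le> w powr lam"
    using c assms by (simp add: powr_minus field_simps)
  also have "\<dots> \<longleftrightarrow> \<not> (w powr lam < inverse (- ln ?u))" by auto
  also have "\<dots> \<longleftrightarrow> inverse (- ln ?u) powr (1/lam) \<le> w"
  proof
    assume "\<not> (w powr lam < inverse (- ln ?u))"
    then have "inverse (- ln ?u) powr (1/lam) \<le> (w powr lam) powr (1/lam)"
      using c assms by (intro powr_mono2) auto
    then show "inverse (- ln ?u) powr (1/lam) \<le> w" using assms by (simp add: powr_powr)
  next
    assume "inverse (- ln ?u) powr (1/lam) \<le> w"
    then have "(inverse (- ln ?u) powr (1/lam)) powr lam \<le> w powr lam"
      using c assms by (intro powr_mono2) auto
    moreover have "(inverse (- ln ?u) powr (1/lam)) powr lam = inverse (- ln ?u)"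
      using c assms by (simp add: powr_powr)
    ultimately show "\<not> (w powr lam < inverse (- ln ?u))" by linarith
  qed
  also have "inverse (- ln ?u) powr (1/lam) = std_quantile \<alpha> lam y"
    by (simp only: std_quantile_def powr_minus inverse_powr)
  finally show ?thesis .
qed

text \<open>Follows from the Galois connection alone: \<open>y'\<close> is at most the value of
  \<open>std_cdf\<close> at its own quantile, hence so is \<open>y\<close>.\<close>

lemma std_quantile_mono:
  assumes "\<alpha> > 0" "lam > 0" "0 < y" "y \<le> y'" "y' < 1"
  shows "std_quantile \<alpha> lam y \<le> std_quantile \<alpha> lam y'"
proof -
  have p: "0 < std_quantile \<alpha> lam y'" using assms by (intro std_quantile_pos) auto
  have "y' \<le> std_cdf \<alpha> lam (std_quantile \<alpha> lam y')"
    using std_galois[of \<alpha> lam "std_quantile \<alpha> lam y'" y'] p assms by auto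
  then show ?thesis
    using std_galois[of \<alpha> lam "std_quantile \<alpha> lam y'" y] p assms by auto
qed

section \<open>The sign change of the left gap and the threshold level\<close>

text \<open>Strictness comes from the coefficient
  \<open>2 * (1 - p) / (2 - p) = 2 - 2 / (2 - p)\<close>, which strictly decreases and multiplies a
  positive median; weak monotonicity of the quantile is then enough.\<close>

lemma left_gap_strict_mono:
  assumes "\<alpha> > 0" "lam > 0" "0 < p" "p < q" "q < 1"
  shows "left_gap \<alpha> lam p < left_gap \<alpha> lam q"
proof -
  have "2 * (1 - q) / (2 - q) < 2 * (1 - p) / (2 - p)"
    using assms by (simp add: field_simps)
  moreover have "0 < std_quantile \<alpha> lam (1/2)" using assms by (intro std_quantile_pos) auto
  ultimately have "2 * (1 - q) / (2 - q) * std_quantile \<alpha> lam (1/2)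
      < 2 * (1 - p) / (2 - p) * std_quantile \<alpha> lam (1/2)"
    by (rule mult_strict_right_mono)
  moreover have "std_quantile \<alpha> lam p \<le> std_quantile \<alpha> lam q"
    using assms by (intro std_quantile_mono) auto
  ultimately show ?thesis unfolding left_gap_def by linarith
qed

text \<open>The map \<open>t powr (- (1 / lam))\<close> is injective on positive reals and sends
  \<open>r powr lam\<close> to \<open>1 / r\<close>.\<close>

lemma powr_mult_eq_iff_root:
  fixes r a b lam :: real
  assumes "0 < r" "0 < a" "0 < b" "0 < lam"
  shows "r powr lam * a = b \<longleftrightarrow> a powr (- (1 / lam)) = r * b powr (- (1 / lam))"
proof
  assume "r powr lam * a = b"
  then show "a powr (- (1 / lam)) = r * b powr (- (1 / lam))"
    using assms by (auto simp: powr_mult powr_powr powr_minus)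
next
  assume "a powr (- (1 / lam)) = r * b powr (- (1 / lam))"
  then have "(a powr (- (1 / lam))) powr (- lam) = (r * b powr (- (1 / lam))) powr (- lam)" by simp
  then have "a = inverse (r powr lam) * b"
    using assms by (simp only: powr_mult powr_powr) (simp add: powr_minus)
  then show "r powr lam * a = b" using assms by simp
qed

lemma left_threshold_iff:
  assumes "\<alpha> > 0" "lam > 0"
  shows "left_threshold \<alpha> lam p \<longleftrightarrow> 0 < p \<and> p \<le> 1/2 \<and> left_gap \<alpha> lam p = 0"
proof (cases "0 < p \<and> p \<le> 1/2")
  case False
  then show ?thesis by (auto simp: left_threshold_def)
next
  case True
  let ?r = "2 * (1 - p) / (2 - p)"
  let ?a = "- ln (1 - (1 - p) powr (1 / \<alpha>))" and ?b = "- ln (1 - (1 - 1/2) powr (1 / \<alpha>))"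
  have r: "0 < ?r" using True by simp
  have a: "0 < ?a" using True assms by (intro neg_ln_pos) auto
  have b: "0 < ?b" using assms by (intro neg_ln_pos) auto
  \<comment> \<open>Both logarithms in the threshold equation are negative; changing signs gives
    positive numbers, of which roots can be taken.\<close>
  have "left_threshold \<alpha> lam p \<longleftrightarrow> ?r powr lam * ?a = ?b"
    using True half_powr[of "1 / \<alpha>"] by (simp only: left_threshold_def) (simp del: times_divide_eq_left)
  also have "\<dots> \<longleftrightarrow> ?a powr (- (1/lam)) = ?r * ?b powr (- (1/lam))"
    using r a b assms by (intro powr_mult_eq_iff_root) auto
  also have "\<dots> \<longleftrightarrow> left_gap \<alpha> lam p = 0"
    by (simp add: left_gap_def std_quantile_def)
  finally show ?thesis using True by simp
qed

lemma continuous_on_left_gap: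
  assumes "\<alpha> > 0" "lam > 0" "S \<subseteq> {0<..<1}"
  shows "continuous_on S (left_gap \<alpha> lam)"
proof -
  have "1 - (1 - y) powr (1 / \<alpha>) \<noteq> 0" "ln (1 - (1 - y) powr (1 / \<alpha>)) \<noteq> 0" if "y \<in> S" for y
    using that assms powr_unit_bounds[of y "1/\<alpha>"] neg_ln_pos[of y \<alpha>] by fastforce+
  moreover have "1 - y \<noteq> 0" "2 - y \<noteq> 0" if "y \<in> S" for y using that assms by force+
  ultimately show ?thesis
    unfolding left_gap_def std_quantile_def by (intro continuous_intros) auto
qed

text \<open>Existence is the intermediate value theorem for \<open>left_gap\<close>, uniqueness its
  strict monotonicity.\<close>

lemma left_threshold_ex1:
  assumes "\<alpha> > 0" "lam > 0"
  shows "\<exists>!p. left_threshold \<alpha> lam p"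
proof (rule ex_ex1I)
  let ?m = "std_quantile \<alpha> lam (1/2)"
  \<comment> \<open>The number 2/3 is the coefficient \<open>2 * (1 - p) / (2 - p)\<close> at
    \<open>p = 1/2\<close>, hence a lower bound for it at smaller levels. The level
    \<open>?e\<close> of \<open>?w\<close> lies below 1/2 and has quantile at most
    \<open>?w\<close>, so the gap there is not positive.\<close>
  let ?w = "2/3 * ?m"
  let ?e = "std_cdf \<alpha> lam ?w"
  have m: "0 < ?m" using assms by (intro std_quantile_pos) auto
  have e: "0 < ?e" "?e < 1" using m assms by (auto intro!: std_cdf_bounds)
  have e2: "?e < 1/2" using std_galois[of \<alpha> lam ?w "1/2"] assms m by auto
  have "2/3 \<le> 2 * (1 - ?e) / (2 - ?e)" using e2 by (simp add: field_simps)
  then have "?w \<le> 2 * (1 - ?e) / (2 - ?e) * ?m" using m by (intro mult_right_mono) auto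
  moreover have "std_quantile \<alpha> lam ?e \<le> ?w"
    using std_galois[of \<alpha> lam ?w ?e] assms m e by auto
  ultimately have "left_gap \<alpha> lam ?e \<le> 0" unfolding left_gap_def by linarith
  moreover have "0 \<le> left_gap \<alpha> lam (1/2)" using m by (simp add: left_gap_def)
  moreover have "continuous_on {?e..1/2} (left_gap \<alpha> lam)"
    using e assms by (intro continuous_on_left_gap) auto
  ultimately obtain x where "?e \<le> x" "x \<le> 1/2" "left_gap \<alpha> lam x = 0"
    using IVT'[of "left_gap \<alpha> lam" ?e 0 "1/2"] e2 by auto
  then show "\<exists>p. left_threshold \<alpha> lam p"
    using e assms left_threshold_iff[of \<alpha> lam x] by (intro exI[of _ x]) linarith
next
  fix p q assume "left_threshold \<alpha> lam p" "left_threshold \<alpha> lam q"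
  then show "p = q"
    using left_gap_strict_mono[of \<alpha> lam p q] left_gap_strict_mono[of \<alpha> lam q p] assms
    by (cases p q rule: linorder_cases) (auto simp: left_threshold_iff)
qed

section \<open>Quantiles and fences of \<open>X\<close>\<close>

lemma exp_frechet_cdf:
  assumes "exp_frechet M X \<alpha> lam \<mu> \<sigma>"
  shows "cdf (distr M borel X) x = (if x > \<mu> then std_cdf \<alpha> lam ((x - \<mu>) / \<sigma>) else 0)"
  using assms by (simp add: exp_frechet_def std_cdf_def)

text \<open>By the Galois connection the set under the infimum is a closed ray, and its left end is
  the quantile. Points up to \<open>\<mu>\<close> are outside on both sides: there the distribution
  function is 0, while the ray starts beyond \<open>\<mu>\<close>.\<close>

lemma exp_frechet_quantile:
  assumes "exp_frechet M X \<alpha> lam \<mu> \<sigma>" "\<alpha> > 0" "lam > 0" "\<sigma> > 0" "0 < y" "y < 1"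
  shows "quantile M X y = \<mu> + \<sigma> * std_quantile \<alpha> lam y"
proof -
  have p: "0 < std_quantile \<alpha> lam y" using assms by (intro std_quantile_pos) auto
  have "y \<le> cdf (distr M borel X) x \<longleftrightarrow> \<mu> + \<sigma> * std_quantile \<alpha> lam y \<le> x" for x
  proof (cases "x > \<mu>")
    case True
    then have "y \<le> cdf (distr M borel X) x \<longleftrightarrow> std_quantile \<alpha> lam y \<le> (x - \<mu>) / \<sigma>"
      using std_galois[of \<alpha> lam "(x - \<mu>) / \<sigma>" y] assms by (simp add: exp_frechet_cdf[OF assms(1)])
    then show ?thesis using assms by (simp add: field_simps)
  next
    case False
    have "0 < \<sigma> * std_quantile \<alpha> lam y" using p assms by simp
    then have "\<not> \<mu> + \<sigma> * std_quantile \<alpha> lam y \<le> x" using False by linarith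
    then show ?thesis using False assms by (simp add: exp_frechet_cdf[OF assms(1)])
  qed
  then have "{x. y \<le> cdf (distr M borel X) x} = {\<mu> + \<sigma> * std_quantile \<alpha> lam y..}" by auto
  then show ?thesis by (simp add: quantile_def)
qed

text \<open>The quantile at \<open>p\<close> is collected with
  \<open>1 + 2 * (1 - p) / p = (2 - p) / p\<close>, and the shifts by \<open>\<mu>\<close> in the
  difference of quantiles cancel.\<close>

lemma left_fence_eq:
  assumes "exp_frechet M X \<alpha> lam \<mu> \<sigma>" "\<alpha> > 0" "lam > 0" "\<sigma> > 0" "0 < p" "p < 1"
  shows "left_fence M X p = \<mu> + \<sigma> * ((2 - p) / p * std_quantile \<alpha> lam p
           - 2 * ((1 - p) / p) * std_quantile \<alpha> lam (1/2))"
  using assms by (simp add: left_fence_def exp_frechet_quantile[OF assms(1-4)]) (simp add: field_simps)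

lemma right_fence_eq:
  assumes "exp_frechet M X \<alpha> lam \<mu> \<sigma>" "\<alpha> > 0" "lam > 0" "\<sigma> > 0" "0 < p" "p < 1"
  shows "right_fence M X p = \<mu> + \<sigma> * ((2 - p) / p * std_quantile \<alpha> lam (1 - p)
           - 2 * ((1 - p) / p) * std_quantile \<alpha> lam (1/2))"
  using assms by (simp add: right_fence_def exp_frechet_quantile[OF assms(1-4)]) (simp add: field_simps)

lemma left_gap_scaled:
  assumes "0 < p" "p < 1"
  shows "(2 - p) / p * std_quantile \<alpha> lam p - 2 * ((1 - p) / p) * std_quantile \<alpha> lam (1/2)
    = (2 - p) / p * left_gap \<alpha> lam p"
proof -
  have "(2 - p) / p * (2 * (1 - p) / (2 - p)) = 2 * ((1 - p) / p)"
    using assms by (simp add: field_simps)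
  then show ?thesis
    by (simp only: left_gap_def right_diff_distrib mult.assoc[symmetric])
qed

section \<open>Outside probabilities as values of the distribution function\<close>

lemma (in prob_space) prob_le_eq_cdf:
  assumes "X \<in> borel_measurable M"
  shows "measure M {\<omega> \<in> space M. X \<omega> \<le> x} = cdf (distr M borel X) x"
  using assms by (auto simp: cdf_def measure_distr intro!: arg_cong[where f = "measure M"])

lemma (in prob_space) prob_gt_eq_cdf:
  assumes [measurable]: "X \<in> borel_measurable M"
  shows "measure M {\<omega> \<in> space M. X \<omega> > x} = 1 - cdf (distr M borel X) x"
proof -
  have "{\<omega> \<in> space M. X \<omega> > x} = space M - {\<omega> \<in> space M. X \<omega> \<le> x}" by auto
  then show ?thesis by (simp add: prob_compl prob_le_eq_cdf)
qed

text \<open>The strict and the weak event differ by the atom at \<open>x\<close>, which continuity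
  of the distribution function excludes.\<close>

lemma (in prob_space) prob_less_eq_cdf:
  assumes [measurable]: "X \<in> borel_measurable M" and "isCont (cdf (distr M borel X)) x"
  shows "measure M {\<omega> \<in> space M. X \<omega> < x} = cdf (distr M borel X) x"
proof -
  interpret D: prob_space "distr M borel X" by (rule prob_space_distr) simp
  interpret finite_borel_measure "distr M borel X" by unfold_locales simp
  have "measure (distr M borel X) {x} = 0" using assms(2) by (simp add: isCont_cdf)
  then have "measure M {\<omega> \<in> space M. X \<omega> = x} = 0"
    by (simp add: measure_distr vimage_def Int_def conj_commute)
  moreover have "{\<omega> \<in> space M. X \<omega> \<le> x} = {\<omega> \<in> space M. X \<omega> < x} \<union> {\<omega> \<in> space M. X \<omega> = x}"
    by auto
  then have "measure M {\<omega> \<in> space M. X \<omega> \<le> x}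
      = measure M {\<omega> \<in> space M. X \<omega> < x} + measure M {\<omega> \<in> space M. X \<omega> = x}"
    by (simp only:) (rule finite_measure_Union; auto)
  ultimately show ?thesis by (simp add: prob_le_eq_cdf)
qed

text \<open>The ray beyond \<open>\<mu>\<close> is open, so only the positive branch of the
  distribution function matters near \<open>x\<close>.\<close>

lemma exp_frechet_isCont_cdf:
  assumes "exp_frechet M X \<alpha> lam \<mu> \<sigma>" "\<sigma> > 0" "\<mu> < x"
  shows "isCont (cdf (distr M borel X)) x"
proof -
  have "continuous_on {\<mu><..} (\<lambda>x. std_cdf \<alpha> lam ((x - \<mu>) / \<sigma>))"
    unfolding std_cdf_def using assms by (intro continuous_intros) auto
  then have "continuous_on {\<mu><..} (cdf (distr M borel X))"
    by (rule continuous_on_eq) (simp add: exp_frechet_cdf[OF assms(1)])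
  then show ?thesis using assms by (simp add: continuous_on_eq_continuous_at)
qed

theorem theorem1:
  fixes M :: "'a measure" and X :: "'a \<Rightarrow> real" and \<alpha> lam \<mu> \<sigma> :: real
  assumes "prob_space M"
    and "\<alpha> > 0" and "lam > 0" and "\<sigma> > 0"
    and "exp_frechet M X \<alpha> lam \<mu> \<sigma>"
  shows "(\<exists>!p\<^sub>0. left_threshold \<alpha> lam p\<^sub>0) \<and>
    (\<forall>p\<^sub>0 p. left_threshold \<alpha> lam p\<^sub>0 \<and> 0 < p \<and> p \<le> 1/2 \<longrightarrow>
      (p \<le> p\<^sub>0 \<longrightarrow> prob_left_outside M X p = 0) \<and>
      (p\<^sub>0 < p \<longrightarrow> prob_left_outside M X p =
         1 - (1 - exp (- (((2 - p) / p * (- ln (1 - (1 - p) powr (1 / \<alpha>))) powr (- (1 / lam))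
                - 2 * ((1 - p) / p) * (- ln (1 - 2 powr (- (1 / \<alpha>)))) powr (- (1 / lam)))
              powr (- lam)))) powr \<alpha>)) \<and>
    (\<forall>p. 0 < p \<and> p \<le> 1/2 \<longrightarrow>
      prob_right_outside M X p =
        (1 - exp (- (((2 - p) / p * (- ln (1 - p powr (1 / \<alpha>))) powr (- (1 / lam))
               - 2 * ((1 - p) / p) * (- ln (1 - 2 powr (- (1 / \<alpha>)))) powr (- (1 / lam)))
             powr (- lam)))) powr \<alpha>)"
proof -
  interpret prob_space M by fact
  note F = \<open>exp_frechet M X \<alpha> lam \<mu> \<sigma>\<close> and pos = \<open>\<alpha> > 0\<close> \<open>lam > 0\<close> \<open>\<sigma> > 0\<close>
  let ?l = "\<lambda>p. (2 - p) / p * std_quantile \<alpha> lam p - 2 * ((1 - p) / p) * std_quantile \<alpha> lam (1/2)"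
  let ?r = "\<lambda>p. (2 - p) / p * std_quantile \<alpha> lam (1 - p) - 2 * ((1 - p) / p) * std_quantile \<alpha> lam (1/2)"
  have X[measurable]: "X \<in> borel_measurable M" using F by (simp add: exp_frechet_def)
  have left0: "prob_left_outside M X p = 0"
    if "left_threshold \<alpha> lam p\<^sub>0" "0 < p" "p \<le> 1/2" "p \<le> p\<^sub>0" for p\<^sub>0 p
  proof -
    have "left_gap \<alpha> lam p \<le> 0"
      using that left_gap_strict_mono[of \<alpha> lam p p\<^sub>0] pos
      by (cases "p = p\<^sub>0") (auto simp: left_threshold_iff)
    then have "(2 - p) / p * left_gap \<alpha> lam p \<le> 0" using that by (intro mult_nonneg_nonpos) auto
    then have "?l p \<le> 0" using that by (simp only: left_gap_scaled)
    then have "\<sigma> * ?l p \<le> 0" using pos by (intro mult_nonneg_nonpos) auto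
    then have "left_fence M X p \<le> \<mu>" using that by (simp only: left_fence_eq[OF F pos])
    \<comment> \<open>Values below the fence are values up to \<open>\<mu>\<close>, where no mass
      lies. This includes \<open>p = p\<^sub>0\<close>, where the fence is exactly
      \<open>\<mu>\<close>.\<close>
    then have "prob_left_outside M X p \<le> measure M {\<omega> \<in> space M. X \<omega> \<le> \<mu>}"
      unfolding prob_left_outside_def by (intro finite_measure_mono) auto
    also have "\<dots> = 0" by (simp add: prob_le_eq_cdf exp_frechet_cdf[OF F])
    finally show ?thesis by (simp add: prob_left_outside_def measure_le_0_iff)
  qed
  have left1: "prob_left_outside M X p = std_cdf \<alpha> lam (?l p)"
    if "left_threshold \<alpha> lam p\<^sub>0" "0 < p" "p \<le> 1/2" "p\<^sub>0 < p" for p\<^sub>0 p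
  proof -
    have "0 < left_gap \<alpha> lam p"
      using that left_gap_strict_mono[of \<alpha> lam p\<^sub>0 p] pos by (auto simp: left_threshold_iff)
    then have "0 < (2 - p) / p * left_gap \<alpha> lam p" using that by (intro mult_pos_pos) auto
    then have "0 < ?l p" using that by (simp only: left_gap_scaled)
    moreover have L: "left_fence M X p = \<mu> + \<sigma> * ?l p" using that by (intro left_fence_eq[OF F pos]) auto
    ultimately have "\<mu> < left_fence M X p" using pos by (metis less_add_same_cancel1 mult_pos_pos)
    then have "prob_left_outside M X p = std_cdf \<alpha> lam ((left_fence M X p - \<mu>) / \<sigma>)"
      using exp_frechet_isCont_cdf[OF F pos(3)]
      by (simp add: prob_left_outside_def prob_less_eq_cdf exp_frechet_cdf[OF F])
    also have "(left_fence M X p - \<mu>) / \<sigma> = ?l p" unfolding L using pos by simp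
    finally show ?thesis .
  qed
  have right: "prob_right_outside M X p = 1 - std_cdf \<alpha> lam (?r p)" if "0 < p" "p \<le> 1/2" for p
  proof -
    have "0 < std_quantile \<alpha> lam (1 - p)" using that pos by (intro std_quantile_pos) auto
    moreover have "std_quantile \<alpha> lam (1/2) \<le> std_quantile \<alpha> lam (1 - p)"
      using that pos by (intro std_quantile_mono) auto
    then have "2 * ((1 - p) / p) * std_quantile \<alpha> lam (1/2)
        \<le> 2 * ((1 - p) / p) * std_quantile \<alpha> lam (1 - p)"
      using that by (intro mult_left_mono) auto
    \<comment> \<open>Since \<open>1 - p\<close> is at least 1/2, this splitting bounds
      \<open>?r p\<close> below by the quantile at \<open>1 - p\<close>. The right fence therefore
      always exceeds \<open>\<mu>\<close>, and no threshold arises.\<close>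
    moreover have "(2 - p) / p * std_quantile \<alpha> lam (1 - p)
        = std_quantile \<alpha> lam (1 - p) + 2 * ((1 - p) / p) * std_quantile \<alpha> lam (1 - p)"
      using that by (simp add: field_simps)
    ultimately have "0 < ?r p" by linarith
    moreover have R: "right_fence M X p = \<mu> + \<sigma> * ?r p" using that by (intro right_fence_eq[OF F pos]) auto
    ultimately have "\<mu> < right_fence M X p" using pos by (metis less_add_same_cancel1 mult_pos_pos)
    then have "prob_right_outside M X p = 1 - std_cdf \<alpha> lam ((right_fence M X p - \<mu>) / \<sigma>)"
      by (simp add: prob_right_outside_def prob_gt_eq_cdf exp_frechet_cdf[OF F])
    also have "(right_fence M X p - \<mu>) / \<sigma> = ?r p" unfolding R using pos by simp
    finally show ?thesis .
  qed
  \<comment> \<open>Rewrites the quantile at level \<open>1 - p\<close> to the printed form with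
    \<open>p powr (1 / \<alpha>)\<close>.\<close>
  have r: "1 - (1 - p) = p" for p :: real by simp
  show ?thesis
    using left_threshold_ex1[OF pos(1,2)] left0
      left1[unfolded std_cdf_def std_quantile_def half_powr]
      right[unfolded std_cdf_def std_quantile_def half_powr r]
    by (intro conjI allI impI) auto
qed

end
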